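(* Let $\mathbf T$ be a nominal transition system with a nominal set $\mathcal F$ of effects and an equivariant function $L\colon\mathrm{ACT}_{\mathbf T}\times\mathcal P_{\mathrm{fs}}(\mathcal F)\times\mathcal F\to\mathcal P_{\mathrm{fs}}(\mathcal F)$, and let $L(\mathbf T)$ be its $L$-transform. For all $F\in\mathcal P_{\mathrm{fs}}(\mathcal F)$ and states $P,Q$ of $\mathbf T$: if $\mathrm{EF}(F,P)\stackrel{\cdot}{\sim}\mathrm{EF}(F,Q)$ in $L(\mathbf T)$, then $P\stackrel{F/L}{\sim}Q$ in $\mathbf T$.
   Context: Nominal sets over a countably infinite (possibly sorted) set of names $\mathcal N$: permutations fix all but finitely many names; every element has finite support $\operatorname{supp}$; $a\# X$ means $a\notin\operatorname{supp}(X)$; $N\# X,Y$ means every $a\in N$ is fresh for $X$ and $Y$; $[\mathcal P_{\mathrm{fin}}(\mathcal N)]S$ is $\mathcal P_{\mathrm{fin}}(\mathcal N)\times S$ modulo $(N,X)=_\alpha(N',X')$ iff some $\pi$ with $\pi\cdot(N,X)=(N',X')$ fixes every name of $\operatorname{supp}(X)\setminus N$; classes $\langle N\rangle X$. A nominal transition system: nominal sets STATES, PRED, ACT; equivariant $\vdash\subseteq\mathrm{STATES}\times\mathrm{PRED}$; equivariant $\operatorname{bn}$, $\operatorname{bn}(\alpha)$ a finite subset of $\operatorname{supp}(\alpha)$; equivariant $\rightarrow\ \subseteq\mathrm{STATES}\times[\mathcal P_{\mathrm{fin}}(\mathcal N)](\mathrm{ACT}\times\mathrm{STATES})$ with $(P,\langle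 N\rangle(\alpha,Q))\in\rightarrow$ only if $N=\operatorname{bn}(\alpha)$; $P\xrightarrow{\alpha}P'$ means $(P,\langle\operatorname{bn}(\alpha)\rangle(\alpha,P'))\in\rightarrow$. A bisimulation is a symmetric relation $R$ on states with: $R(P,Q)$ implies (1) $P\vdash\varphi\Rightarrow Q\vdash\varphi$ for all $\varphi$; (2) whenever $\operatorname{bn}(\alpha)\# Q$ and $P\xrightarrow{\alpha}P'$ there is $Q'$ with $Q\xrightarrow{\alpha}Q'$ and $R(P',Q')$. $\stackrel{\cdot}{\sim}$ is the union of all bisimulations. An effect is a finitely supported function from states to states; $\mathcal F$ is a nominal set of effects; $\mathcal P_{\mathrm{fs}}(\mathcal F)$ its finitely supported subsets. An $L$-bisimulation is a family $\{R_F\}_{F\in\mathcal P_{\mathrm{fs}}(\mathcal F)}$ of symmetric relations on states with: $R_F(P,Q)$ implies (1) for all $f\in F$, $\varphi$: $f(P)\vdash\varphi\Rightarrow f(Q)\vdash\varphi$; (2) for all $f\in F$, $\alpha,P'$ with $\operatorname{bn}(\alpha)\# f(Q),F,f$: if $f(P)\xrightarrow{\alpha}P'$ then some $Q'$ has $f(Q)\xrightarrow{\alpha}Q'$ and $R_{L(\alpha,F,f)}(P',Q')$. $P\stackrel{F/L}{\sim}Q$ iff some $L$-bisimulation has $R_F(P,Q)$. The $L$-transform $L(\mathbf T)$ is the nominal transition system with: states $\mathrm{AC}(f,F,P)$ ($f\in\mathcal F$, $F\in\mathcal P_{\mathrm{fs}}(\mathcal F)$, $P\in\mathrm{STATES}_{\mathbf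 T}$) and $\mathrm{EF}(F,P)$ ($F\in\mathcal P_{\mathrm{fs}}(\mathcal F)$, $P\in\mathrm{STATES}_{\mathbf T}$), permutations acting componentwise; predicates $\mathrm{PRED}_{\mathbf T}$ with $\mathrm{AC}(f,F,P)\vdash\varphi$ iff $P\vdash_{\mathbf T}\varphi$ and $\mathrm{EF}(F,P)\vdash\varphi$ never; actions $\mathrm{ACT}_{\mathbf T}\uplus\mathcal F$, with $\operatorname{bn}$ as in $\mathbf T$ on $\mathrm{ACT}_{\mathbf T}$ and $\operatorname{bn}(f)=\emptyset$ for $f\in\mathcal F$; transitions: $\mathrm{AC}(f,F,P)\xrightarrow{\alpha}\mathrm{EF}(L(\alpha,F,f),P')$ whenever $P\xrightarrow{\alpha}P'$ in $\mathbf T$ with $\operatorname{bn}(\alpha)\# f,F$, and $\mathrm{EF}(F,P)\xrightarrow{f}\mathrm{AC}(f,F,f(P))$ for each $f\in F$. *)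

theory Defs
  imports
    "HOL-Combinatorics.Perm"
    "HOL-Library.Countable"
    "HOL-Library.FuncSet"
begin

unbundle permutation_syntax

section \<open>Names, permutations and nominal sets\<close>

text \<open>
  As there are only countably many names, sorts can be coded as natural numbers. Every inhabited
  sort is infinite; in the unsorted case the sort function is constant.
\<close>

class name = countable +
  fixes sort_of :: "'a \<Rightarrow> nat"
  assumes infinite_sort: "infinite {b. sort_of b = sort_of a}"

text \<open>Finiteness of the set of moved names is built into the type \<^typ>\<open>'n perm\<close>.\<close>

definition perms :: "'n::name perm set" where
  "perms = {\<pi>. \<forall>a. sort_of (\<pi> \<langle>$\<rangle> a) = sort_of a}"

record ('n, 'a) nomset =
  elems :: "'a set"
  act :: "'n perm \<Rightarrow> 'a \<Rightarrow> 'a"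

definition supports :: "('n::name, 'a) nomset \<Rightarrow> 'n set \<Rightarrow> 'a \<Rightarrow> bool" where
  "supports A N x \<longleftrightarrow> (\<forall>\<pi>\<in>perms. (\<forall>a\<in>N. \<pi> \<langle>$\<rangle> a = a) \<longrightarrow> act A \<pi> x = x)"

definition finitely_supported :: "('n::name, 'a) nomset \<Rightarrow> 'a \<Rightarrow> bool" where
  "finitely_supported A x \<longleftrightarrow> (\<exists>N. finite N \<and> supports A N x)"

definition nominal_set :: "('n::name, 'a) nomset \<Rightarrow> bool" where
  "nominal_set A \<longleftrightarrow>
    (\<forall>\<pi>\<in>perms. \<forall>x\<in>elems A. act A \<pi> x \<in> elems A) \<and>
    (\<forall>x\<in>elems A. act A 1 x = x) \<and>
    (\<forall>\<pi>\<in>perms. \<forall>\<rho>\<in>perms. \<forall>x\<in>elems A. act A (\<pi> * \<rho>) x = act A \<pi> (act A \<rho> x)) \<and>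
    (\<forall>x\<in>elems A. finitely_supported A x)"

text \<open>
  In a nominal set the intersection is itself a finite supporting set, i.e. the least one.
\<close>

definition supp :: "('n::name, 'a) nomset \<Rightarrow> 'a \<Rightarrow> 'n set" where
  "supp A x = \<Inter>{N. finite N \<and> supports A N x}"

definition fresh :: "('n::name, 'a) nomset \<Rightarrow> 'n set \<Rightarrow> 'a \<Rightarrow> bool" where
  "fresh A N x \<longleftrightarrow> (\<forall>a\<in>N. a \<notin> supp A x)"

definition equivariant_set :: "('n::name, 'a) nomset \<Rightarrow> 'a set \<Rightarrow> bool" where
  "equivariant_set A X \<longleftrightarrow> X \<subseteq> elems A \<and> (\<forall>\<pi>\<in>perms. \<forall>x\<in>X. act A \<pi> x \<in> X)"

definition equivariant_fun ::
  "('n::name, 'a) nomset \<Rightarrow> ('n, 'b) nomset \<Rightarrow> ('a \<Rightarrow> 'b) \<Rightarrow> bool" where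
  "equivariant_fun A B h \<longleftrightarrow>
    h \<in> elems A \<rightarrow> elems B \<and> (\<forall>\<pi>\<in>perms. \<forall>x\<in>elems A. h (act A \<pi> x) = act B \<pi> (h x))"

definition prod_ns :: "('n, 'a) nomset \<Rightarrow> ('n, 'b) nomset \<Rightarrow> ('n, 'a \<times> 'b) nomset" where
  "prod_ns A B = \<lparr>elems = elems A \<times> elems B, act = (\<lambda>\<pi>. map_prod (act A \<pi>) (act B \<pi>))\<rparr>"

definition sum_ns :: "('n, 'a) nomset \<Rightarrow> ('n, 'b) nomset \<Rightarrow> ('n, 'a + 'b) nomset" where
  "sum_ns A B = \<lparr>elems = elems A <+> elems B, act = (\<lambda>\<pi>. map_sum (act A \<pi>) (act B \<pi>))\<rparr>"

definition pow_ns :: "('n, 'a) nomset \<Rightarrow> ('n, 'a set) nomset" where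
  "pow_ns A = \<lparr>elems = Pow (elems A), act = (\<lambda>\<pi> X. act A \<pi> ` X)\<rparr>"

definition pfs_ns :: "('n::name, 'a) nomset \<Rightarrow> ('n, 'a set) nomset" where
  "pfs_ns A = (pow_ns A)\<lparr>elems := {X \<in> elems (pow_ns A). finitely_supported (pow_ns A) X}\<rparr>"

definition name_ns :: "('n, 'n) nomset" where
  "name_ns = \<lparr>elems = UNIV, act = (\<lambda>\<pi> a. \<pi> \<langle>$\<rangle> a)\<rparr>"

definition pfin_name_ns :: "('n, 'n set) nomset" where
  "pfin_name_ns = (pow_ns name_ns)\<lparr>elems := {N. finite N}\<rparr>"

text \<open>
  Functions between nominal sets are represented by extensional functions on the carriers, so the
  conjugation action has to be restricted to the carrier of the domain.
\<close>

definition fun_ns :: "('n, 'a) nomset \<Rightarrow> ('n, 'b) nomset \<Rightarrow> ('n, 'a \<Rightarrow> 'b) nomset" where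
  "fun_ns A B = \<lparr>elems = elems A \<rightarrow>\<^sub>E elems B,
    act = (\<lambda>\<pi> f. \<lambda>x\<in>elems A. act B \<pi> (f (act A (inverse \<pi>) x)))\<rparr>"

definition alpha_rel :: "('n::name, 'a) nomset \<Rightarrow> ('n set \<times> 'a) rel" where
  "alpha_rel A = {((N, x), (N', x')).
    (N, x) \<in> elems (prod_ns pfin_name_ns A) \<and> (N', x') \<in> elems (prod_ns pfin_name_ns A) \<and>
    (\<exists>\<pi>\<in>perms. act (prod_ns pfin_name_ns A) \<pi> (N, x) = (N', x') \<and>
      (\<forall>a\<in>supp A x - N. \<pi> \<langle>$\<rangle> a = a))}"

text \<open>\<open>abstr A N x\<close> is the class \<open>\<langle>N\<rangle>x\<close>.\<close>

definition abstr :: "('n::name, 'a) nomset \<Rightarrow> 'n set \<Rightarrow> 'a \<Rightarrow> ('n set \<times> 'a) set" where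
  "abstr A N x = alpha_rel A `` {(N, x)}"

definition abs_ns :: "('n::name, 'a) nomset \<Rightarrow> ('n, ('n set \<times> 'a) set) nomset" where
  "abs_ns A = (pow_ns (prod_ns pfin_name_ns A))
    \<lparr>elems := elems (prod_ns pfin_name_ns A) // alpha_rel A\<rparr>"


section \<open>Nominal transition systems and bisimilarity\<close>

record ('n, 's, 'p, 'a) nts =
  states :: "('n, 's) nomset"
  preds :: "('n, 'p) nomset"
  actions :: "('n, 'a) nomset"
  sat :: "('s \<times> 'p) set"
  bn :: "'a \<Rightarrow> 'n set"
  trans_rel :: "('s \<times> ('n set \<times> ('a \<times> 's)) set) set"

definition residual :: "('n::name, 's, 'p, 'a) nts \<Rightarrow> 'n set \<Rightarrow> 'a \<times> 's \<Rightarrow> ('n set \<times> ('a \<times> 's)) set"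
  where "residual T = abstr (prod_ns (actions T) (states T))"

definition nominal_transition_system :: "('n::name, 's, 'p, 'a) nts \<Rightarrow> bool" where
  "nominal_transition_system T \<longleftrightarrow>
    nominal_set (states T) \<and> nominal_set (preds T) \<and> nominal_set (actions T) \<and>
    equivariant_set (prod_ns (states T) (preds T)) (sat T) \<and>
    equivariant_fun (actions T) pfin_name_ns (bn T) \<and>
    (\<forall>\<alpha>\<in>elems (actions T). bn T \<alpha> \<subseteq> supp (actions T) \<alpha>) \<and>
    equivariant_set (prod_ns (states T) (abs_ns (prod_ns (actions T) (states T)))) (trans_rel T) \<and>
    (\<forall>P\<in>elems (states T). \<forall>N. \<forall>\<alpha>\<in>elems (actions T). \<forall>Q\<in>elems (states T).
      finite N \<longrightarrow> (P, residual T N (\<alpha>, Q)) \<in> trans_rel T \<longrightarrow> N = bn T \<alpha>)"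

definition step :: "('n::name, 's, 'p, 'a) nts \<Rightarrow> 's \<Rightarrow> 'a \<Rightarrow> 's \<Rightarrow> bool" where
  "step T P \<alpha> P' \<longleftrightarrow> (P, residual T (bn T \<alpha>) (\<alpha>, P')) \<in> trans_rel T"

definition bisimulation :: "('n::name, 's, 'p, 'a) nts \<Rightarrow> 's rel \<Rightarrow> bool" where
  "bisimulation T R \<longleftrightarrow>
    R \<subseteq> elems (states T) \<times> elems (states T) \<and> sym R \<and>
    (\<forall>P Q. (P, Q) \<in> R \<longrightarrow>
      (\<forall>\<phi>\<in>elems (preds T). (P, \<phi>) \<in> sat T \<longrightarrow> (Q, \<phi>) \<in> sat T) \<and>
      (\<forall>\<alpha>\<in>elems (actions T). \<forall>P'\<in>elems (states T).
        fresh (states T) (bn T \<alpha>) Q \<longrightarrow> step T P \<alpha> P' \<longrightarrow>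
        (\<exists>Q'\<in>elems (states T). step T Q \<alpha> Q' \<and> (P', Q') \<in> R)))"

definition bisimilarity :: "('n::name, 's, 'p, 'a) nts \<Rightarrow> 's rel" where
  "bisimilarity T = \<Union>{R. bisimulation T R}"


section \<open>Effects, L-bisimilarity and the L-transform\<close>

definition is_effect :: "('n::name, 's, 'p, 'a) nts \<Rightarrow> ('s \<Rightarrow> 's) \<Rightarrow> bool" where
  "is_effect T f \<longleftrightarrow>
    f \<in> elems (fun_ns (states T) (states T)) \<and> finitely_supported (fun_ns (states T) (states T)) f"

definition effect_ns :: "('n, 's, 'p, 'a) nts \<Rightarrow> ('s \<Rightarrow> 's) set \<Rightarrow> ('n, 's \<Rightarrow> 's) nomset" where
  "effect_ns T \<F> = (fun_ns (states T) (states T))\<lparr>elems := \<F>\<rparr>"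

definition nominal_effect_set :: "('n::name, 's, 'p, 'a) nts \<Rightarrow> ('s \<Rightarrow> 's) set \<Rightarrow> bool" where
  "nominal_effect_set T \<F> \<longleftrightarrow> (\<forall>f\<in>\<F>. is_effect T f) \<and> nominal_set (effect_ns T \<F>)"

abbreviation pfs_effects ::
  "('n::name, 's, 'p, 'a) nts \<Rightarrow> ('s \<Rightarrow> 's) set \<Rightarrow> ('n, ('s \<Rightarrow> 's) set) nomset" where
  "pfs_effects T \<F> \<equiv> pfs_ns (effect_ns T \<F>)"

type_synonym ('s, 'a) effect_update = "'a \<times> ('s \<Rightarrow> 's) set \<times> ('s \<Rightarrow> 's) \<Rightarrow> ('s \<Rightarrow> 's) set"

definition equivariant_update ::
  "('n::name, 's, 'p, 'a) nts \<Rightarrow> ('s \<Rightarrow> 's) set \<Rightarrow> ('s, 'a) effect_update \<Rightarrow> bool" where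
  "equivariant_update T \<F> L \<longleftrightarrow>
    equivariant_fun (prod_ns (actions T) (prod_ns (pfs_effects T \<F>) (effect_ns T \<F>)))
      (pfs_effects T \<F>) L"

text \<open>Only the members of the family \<open>R\<close> indexed by finitely supported subsets matter.\<close>

definition L_bisimulation ::
  "('n::name, 's, 'p, 'a) nts \<Rightarrow> ('s \<Rightarrow> 's) set \<Rightarrow> ('s, 'a) effect_update \<Rightarrow>
    (('s \<Rightarrow> 's) set \<Rightarrow> 's rel) \<Rightarrow> bool" where
  "L_bisimulation T \<F> L R \<longleftrightarrow>
    (\<forall>F\<in>elems (pfs_effects T \<F>).
      R F \<subseteq> elems (states T) \<times> elems (states T) \<and> sym (R F) \<and>
      (\<forall>P Q. (P, Q) \<in> R F \<longrightarrow>
        (\<forall>f\<in>F. \<forall>\<phi>\<in>elems (preds T). (f P, \<phi>) \<in> sat T \<longrightarrow> (f Q, \<phi>) \<in> sat T) \<and>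
        (\<forall>f\<in>F. \<forall>\<alpha>\<in>elems (actions T). \<forall>P'\<in>elems (states T).
          fresh (states T) (bn T \<alpha>) (f Q) \<and> fresh (pfs_effects T \<F>) (bn T \<alpha>) F \<and>
          fresh (effect_ns T \<F>) (bn T \<alpha>) f \<longrightarrow>
          step T (f P) \<alpha> P' \<longrightarrow>
          (\<exists>Q'\<in>elems (states T). step T (f Q) \<alpha> Q' \<and> (P', Q') \<in> R (L (\<alpha>, F, f))))))"

definition L_bisimilar ::
  "('n::name, 's, 'p, 'a) nts \<Rightarrow> ('s \<Rightarrow> 's) set \<Rightarrow> ('s, 'a) effect_update \<Rightarrow>
    ('s \<Rightarrow> 's) set \<Rightarrow> 's \<Rightarrow> 's \<Rightarrow> bool" where
  "L_bisimilar T \<F> L F P Q \<longleftrightarrow> (\<exists>R. L_bisimulation T \<F> L R \<and> (P, Q) \<in> R F)"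

datatype 's lstate = AC "'s \<Rightarrow> 's" "('s \<Rightarrow> 's) set" 's | EF "('s \<Rightarrow> 's) set" 's

primrec lstate_act :: "('n::name, 's, 'p, 'a) nts \<Rightarrow> ('s \<Rightarrow> 's) set \<Rightarrow> 'n perm \<Rightarrow> 's lstate \<Rightarrow> 's lstate"
  where
    "lstate_act T \<F> \<pi> (AC f F P) =
      AC (act (effect_ns T \<F>) \<pi> f) (act (pfs_effects T \<F>) \<pi> F) (act (states T) \<pi> P)"
  | "lstate_act T \<F> \<pi> (EF F P) = EF (act (pfs_effects T \<F>) \<pi> F) (act (states T) \<pi> P)"

definition lstate_ns :: "('n::name, 's, 'p, 'a) nts \<Rightarrow> ('s \<Rightarrow> 's) set \<Rightarrow> ('n, 's lstate) nomset" where
  "lstate_ns T \<F> = \<lparr>elems =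
      {AC f F P |f F P. f \<in> \<F> \<and> F \<in> elems (pfs_effects T \<F>) \<and> P \<in> elems (states T)} \<union>
      {EF F P |F P. F \<in> elems (pfs_effects T \<F>) \<and> P \<in> elems (states T)},
    act = lstate_act T \<F>\<rparr>"

definition laction_ns ::
  "('n::name, 's, 'p, 'a) nts \<Rightarrow> ('s \<Rightarrow> 's) set \<Rightarrow> ('n, 'a + ('s \<Rightarrow> 's)) nomset" where
  "laction_ns T \<F> = sum_ns (actions T) (effect_ns T \<F>)"

definition lbn :: "('n, 's, 'p, 'a) nts \<Rightarrow> 'a + ('s \<Rightarrow> 's) \<Rightarrow> 'n set" where
  "lbn T = case_sum (bn T) (\<lambda>f. {})"

text \<open>
  The generating transitions are stated with specific representatives; since residuals are
  alpha-equivalence classes, all alpha-variants are transitions of the transform as well.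
\<close>

definition L_transform ::
  "('n::name, 's, 'p, 'a) nts \<Rightarrow> ('s \<Rightarrow> 's) set \<Rightarrow> ('s, 'a) effect_update \<Rightarrow>
    ('n, 's lstate, 'p, 'a + ('s \<Rightarrow> 's)) nts" where
  "L_transform T \<F> L = \<lparr>
    states = lstate_ns T \<F>,
    preds = preds T,
    actions = laction_ns T \<F>,
    sat = {(AC f F P, \<phi>) |f F P \<phi>. AC f F P \<in> elems (lstate_ns T \<F>) \<and> (P, \<phi>) \<in> sat T},
    bn = lbn T,
    trans_rel =
      {(AC f F P, abstr (prod_ns (laction_ns T \<F>) (lstate_ns T \<F>))
          (lbn T (Inl \<alpha>)) (Inl \<alpha>, EF (L (\<alpha>, F, f)) P')) |f F P \<alpha> P'.
        AC f F P \<in> elems (lstate_ns T \<F>) \<and> \<alpha> \<in> elems (actions T) \<and> P' \<in> elems (states T) \<and>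
        step T P \<alpha> P' \<and>
        fresh (effect_ns T \<F>) (bn T \<alpha>) f \<and> fresh (pfs_effects T \<F>) (bn T \<alpha>) F} \<union>
      {(EF F P, abstr (prod_ns (laction_ns T \<F>) (lstate_ns T \<F>))
          (lbn T (Inr f)) (Inr f, AC f F (f P))) |F P f.
        EF F P \<in> elems (lstate_ns T \<F>) \<and> f \<in> F}\<rparr>"

end

theory Submission
  imports Defs
begin

text \<open>
  If \<open>B\<close> is a bisimulation on the transform, then the relations
  \<open>R F = {(P, Q). (EF F P, EF F Q) \<in> B}\<close> form an \<open>L\<close>-bisimulation. A transition labelled by an
  effect \<open>f\<close> binds nothing, so it determines its target and hence relates \<open>AC f F (f P)\<close> with
  \<open>AC f F (f Q)\<close>. The answer of \<open>AC f F (f Q)\<close> to an action \<open>\<alpha>\<close> is only known to be an alpha-variant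
  of a generating transition with some action \<open>\<beta>\<close>; as both \<open>bn \<alpha>\<close> and \<open>bn \<beta>\<close> are fresh for
  \<open>f\<close> and \<open>F\<close>, the renaming can be chosen to fix \<open>f\<close> and \<open>F\<close>, so that by equivariance of \<open>L\<close> it
  turns the index \<open>L (\<beta>, F, f)\<close> into \<open>L (\<alpha>, F, f)\<close>.
\<close>

section \<open>Sort-preserving permutations\<close>

lemma perms_one: "1 \<in> perms"
  by (simp add: perms_def)

lemma perms_times: "\<pi> \<in> perms \<Longrightarrow> \<rho> \<in> perms \<Longrightarrow> \<pi> * \<rho> \<in> perms"
  by (simp add: perms_def apply_times)

lemma apply_inverse_apply [simp]: "inverse \<pi> \<langle>$\<rangle> (\<pi> \<langle>$\<rangle> a) = a"
  by (simp add: apply_sequence)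

lemma apply_apply_inverse [simp]: "\<pi> \<langle>$\<rangle> (inverse \<pi> \<langle>$\<rangle> a) = a"
  by (simp add: apply_sequence)

lemma perms_inverse: "\<pi> \<in> perms \<Longrightarrow> inverse \<pi> \<in> perms"
  unfolding perms_def by simp (metis apply_apply_inverse)

lemma perms_swap: "sort_of a = sort_of b \<Longrightarrow> \<langle>a \<leftrightarrow> b\<rangle> \<in> perms"
  unfolding perms_def by simp (metis apply_swap_same apply_swap_simp)

text \<open>Keeps the values of \<open>\<pi>\<close> on a finite set while moving as few other names
  as possible; \<open>abstr_eq_renaming\<close> needs this to leave fresh names alone. By induction
  on \<open>N\<close>: the permutation obtained for \<open>N\<close> is followed by a swap that
  corrects its value at the new name.\<close>

lemma ex_perm_agreeing_on:
  assumes "finite N" "\<pi> \<in> perms"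
  shows "\<exists>\<rho>\<in>perms. (\<forall>a\<in>N. \<rho> \<langle>$\<rangle> a = \<pi> \<langle>$\<rangle> a) \<and> (\<forall>a. a \<notin> N \<union> apply \<pi> ` N \<longrightarrow> \<rho> \<langle>$\<rangle> a = a)"
  using assms(1)
proof (induction N)
  case empty
  show ?case by (rule bexI[OF _ perms_one]) simp
next
  case (insert a N)
  then obtain \<rho> where \<rho>: "\<rho> \<in> perms" "\<And>b. b \<in> N \<Longrightarrow> \<rho> \<langle>$\<rangle> b = \<pi> \<langle>$\<rangle> b"
    "\<And>b. b \<notin> N \<union> apply \<pi> ` N \<Longrightarrow> \<rho> \<langle>$\<rangle> b = b"
    by blast
  \<comment> \<open>The swap sends \<open>\<rho> a\<close> to the desired \<open>\<pi> a\<close>. By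
    injectivity both names differ from the values already fixed on \<open>N\<close>, so those values
    survive. It preserves sorts because \<open>\<rho>\<close> and \<open>\<pi>\<close> do.\<close>
  let ?\<sigma> = "\<langle>\<rho> \<langle>$\<rangle> a \<leftrightarrow> \<pi> \<langle>$\<rangle> a\<rangle>"
  have "sort_of (\<rho> \<langle>$\<rangle> a) = sort_of (\<pi> \<langle>$\<rangle> a)"
    using \<rho>(1) assms(2) by (simp add: perms_def)
  then have "?\<sigma> * \<rho> \<in> perms"
    using \<rho>(1) by (intro perms_times perms_swap)
  moreover have "(?\<sigma> * \<rho>) \<langle>$\<rangle> b = \<pi> \<langle>$\<rangle> b" if "b \<in> insert a N" for b
  proof (cases "b = a")
    case False
    then have "\<rho> \<langle>$\<rangle> b \<noteq> \<rho> \<langle>$\<rangle> a" "\<pi> \<langle>$\<rangle> b \<noteq> \<pi> \<langle>$\<rangle> a"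
      by (simp_all add: apply_inj)
    moreover have "\<rho> \<langle>$\<rangle> b = \<pi> \<langle>$\<rangle> b"
      using that False \<rho>(2) by simp
    ultimately show ?thesis by (simp add: apply_times)
  qed (simp add: apply_times)
  moreover have "(?\<sigma> * \<rho>) \<langle>$\<rangle> b = b" if "b \<notin> insert a N \<union> apply \<pi> ` insert a N" for b
  proof -
    have "\<rho> \<langle>$\<rangle> b = b" using that \<rho>(3) by auto
    moreover from this have "b \<noteq> \<rho> \<langle>$\<rangle> a" using that by (metis UnCI apply_inj insertI1)
    ultimately show ?thesis using that by (simp add: apply_times)
  qed
  ultimately show ?case by blast
qed

text \<open>Every inhabited sort is infinite, so each name of \<open>M\<close> can in turn be
  swapped with a name of its own sort outside the finite set \<open>K\<close> and outside the images
  chosen so far.\<close>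

lemma ex_perm_moving_away:
  fixes K M :: "'n::name set"
  assumes "finite K" "M \<subseteq> K"
  shows "\<exists>\<sigma>\<in>perms. (\<forall>a\<in>K - M. \<sigma> \<langle>$\<rangle> a = a) \<and> apply \<sigma> ` M \<inter> K = {}"
  using finite_subset[OF assms(2,1)] assms(2)
proof (induction M)
  case empty
  show ?case by (rule bexI[OF _ perms_one]) simp
next
  case (insert a M)
  then obtain \<sigma> where \<sigma>: "\<sigma> \<in> perms" "\<And>b. b \<in> K - M \<Longrightarrow> \<sigma> \<langle>$\<rangle> b = b" "apply \<sigma> ` M \<inter> K = {}"
    by auto
  have "infinite ({b. sort_of b = sort_of a} - (K \<union> apply \<sigma> ` M))"
    using infinite_sort[of a] assms(1) insert.hyps(1) by (simp add: Diff_infinite_finite)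
  then obtain b where b: "sort_of b = sort_of a" "b \<notin> K" "b \<notin> apply \<sigma> ` M"
    using infinite_imp_nonempty by blast
  have "\<langle>a \<leftrightarrow> b\<rangle> * \<sigma> \<in> perms"
    using \<sigma>(1) b(1) by (intro perms_times perms_swap) simp
  moreover have "(\<langle>a \<leftrightarrow> b\<rangle> * \<sigma>) \<langle>$\<rangle> c = c" if "c \<in> K - insert a M" for c
  proof -
    have "c \<noteq> a" "c \<noteq> b" "\<sigma> \<langle>$\<rangle> c = c" using that b \<sigma>(2) by auto
    then show ?thesis by (simp add: apply_times)
  qed
  moreover have "(\<langle>a \<leftrightarrow> b\<rangle> * \<sigma>) \<langle>$\<rangle> c \<notin> K" if "c \<in> insert a M" for c
  proof (cases "c = a")
    case True
    \<comment> \<open>Since \<open>a\<close> lies in \<open>K - M\<close>, the permutation built for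
      \<open>M\<close> does not move it, and the new swap alone carries it to
      \<open>b\<close>.\<close>
    have "\<sigma> \<langle>$\<rangle> a = a" using insert \<sigma>(2) by simp
    then show ?thesis using True b by (simp add: apply_times)
  next
    case False
    with that have "\<sigma> \<langle>$\<rangle> c \<notin> K" "\<sigma> \<langle>$\<rangle> c \<noteq> b" using \<sigma>(3) b(3) by auto
    moreover from this have "\<sigma> \<langle>$\<rangle> c \<noteq> a" using insert.prems by auto
    ultimately show ?thesis by (simp add: apply_times)
  qed
  ultimately show ?case by blast
qed


section \<open>Least supports\<close>

lemma nominal_set_act_in:
  "nominal_set A \<Longrightarrow> \<pi> \<in> perms \<Longrightarrow> x \<in> elems A \<Longrightarrow> act A \<pi> x \<in> elems A"
  by (simp add: nominal_set_def)

lemma nominal_set_act_one: "nominal_set A \<Longrightarrow> x \<in> elems A \<Longrightarrow> act A 1 x = x"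
  by (simp add: nominal_set_def)

lemma nominal_set_act_times:
  "nominal_set A \<Longrightarrow> \<pi> \<in> perms \<Longrightarrow> \<rho> \<in> perms \<Longrightarrow> x \<in> elems A \<Longrightarrow>
    act A (\<pi> * \<rho>) x = act A \<pi> (act A \<rho> x)"
  by (simp add: nominal_set_def)

lemma nominal_set_act_inverse:
  assumes "nominal_set A" "\<pi> \<in> perms" "x \<in> elems A"
  shows "act A (inverse \<pi>) (act A \<pi> x) = x" "act A \<pi> (act A (inverse \<pi>) x) = x"
  using assms by (simp_all add: nominal_set_act_one perms_inverse flip: nominal_set_act_times)

lemma finitely_supportedI: "finite N \<Longrightarrow> supports A N x \<Longrightarrow> finitely_supported A x"
  by (auto simp: finitely_supported_def)

text \<open>The quotient \<open>inverse \<rho> * \<pi>\<close> fixes \<open>N\<close> pointwise and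
  hence fixes \<open>x\<close>.\<close>

lemma supports_cong:
  assumes "nominal_set A" "x \<in> elems A" "supports A N x" "\<pi> \<in> perms" "\<rho> \<in> perms"
    and agree: "\<And>a. a \<in> N \<Longrightarrow> \<pi> \<langle>$\<rangle> a = \<rho> \<langle>$\<rangle> a"
  shows "act A \<pi> x = act A \<rho> x"
proof -
  have "act A (inverse \<rho> * \<pi>) x = x"
    using assms by (simp add: supports_def perms_times perms_inverse apply_times)
  then have "act A \<rho> x = act A (\<rho> * (inverse \<rho> * \<pi>)) x"
    using assms by (simp add: nominal_set_act_times perms_times perms_inverse)
  then show ?thesis by (simp flip: mult.assoc)
qed

lemma supports_act:
  assumes "nominal_set A" "x \<in> elems A" "supports A N x" "\<pi> \<in> perms"
  shows "supports A (apply \<pi> ` N) (act A \<pi> x)"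
  unfolding supports_def
proof (intro ballI impI)
  fix \<rho> assume \<rho>: "\<rho> \<in> perms" "\<forall>a\<in>apply \<pi> ` N. \<rho> \<langle>$\<rangle> a = a"
  then have "act A (\<rho> * \<pi>) x = act A \<pi> x"
    using assms by (intro supports_cong[OF assms(1-3)]) (auto simp: perms_times apply_times)
  then show "act A \<rho> (act A \<pi> x) = act A \<pi> x"
    using assms \<rho> by (simp add: nominal_set_act_times)
qed

text \<open>This is what makes least supports exist. Any \<open>\<sigma>\<close> that fixes
  \<open>x\<close> turns the supporting set \<open>M\<close> into another one, its image under
  \<open>\<sigma>\<close>; it is enough that \<open>\<pi>\<close> fixes that image pointwise, even
  if it moves names of \<open>M - N\<close>.\<close>

lemma supports_Int:
  fixes A :: "('n::name, 'a) nomset"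
  assumes A: "nominal_set A" "x \<in> elems A"
    and M: "finite M" "supports A M x" and N: "finite N" "supports A N x"
  shows "supports A (M \<inter> N) x"
  unfolding supports_def
proof (intro ballI impI)
  fix \<pi> :: "'n perm" assume \<pi>: "\<pi> \<in> perms" "\<forall>a\<in>M \<inter> N. \<pi> \<langle>$\<rangle> a = a"
  let ?K = "M \<union> N \<union> affected \<pi>"
  \<comment> \<open>Move \<open>M - N\<close> away from the names affected by \<open>\<pi>\<close>, using a permutation that fixes \<open>x\<close>.\<close>
  obtain \<sigma> where \<sigma>: "\<sigma> \<in> perms" "\<And>a. a \<in> ?K - (M - N) \<Longrightarrow> \<sigma> \<langle>$\<rangle> a = a"
    "apply \<sigma> ` (M - N) \<inter> ?K = {}"
  proof -
    have "finite ?K" "M - N \<subseteq> ?K" using M(1) N(1) by auto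
    from ex_perm_moving_away[OF this] show ?thesis using that by blast
  qed
  have "act A \<sigma> x = x"
    using N(2) \<sigma>(1,2) by (simp add: supports_def)
  then have "supports A (apply \<sigma> ` M) x"
    using supports_act[OF A M(2) \<sigma>(1)] by simp
  \<comment> \<open>Names in \<open>M \<inter> N\<close> are fixed by both permutations; names in
    \<open>M - N\<close> have been sent to where \<open>\<pi>\<close> acts as the identity.\<close>
  moreover have "\<pi> \<langle>$\<rangle> (\<sigma> \<langle>$\<rangle> a) = \<sigma> \<langle>$\<rangle> a" if "a \<in> M" for a
  proof (cases "a \<in> N")
    case True
    then show ?thesis using that \<pi>(2) \<sigma>(2) by simp
  next
    case False
    then have "\<sigma> \<langle>$\<rangle> a \<notin> affected \<pi>" using that \<sigma>(3) by blast
    then show ?thesis by (simp add: in_affected)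
  qed
  ultimately show "act A \<pi> x = x"
    using \<pi>(1) by (simp add: supports_def)
qed

lemma supp_subset: "finite N \<Longrightarrow> supports A N x \<Longrightarrow> supp A x \<subseteq> N"
  by (auto simp: supp_def)

text \<open>A finite supporting set \<open>N\<close> of least cardinality lies inside every other
  one \<open>M\<close>: by \<open>supports_Int\<close> the set \<open>N \<inter> M\<close> supports
  \<open>x\<close> too, so it cannot be smaller than \<open>N\<close>. Hence \<open>N\<close> is the
  intersection defining \<open>supp\<close>.\<close>

lemma finite_supp_and_supports_supp:
  assumes "nominal_set A" "x \<in> elems A"
  shows "finite (supp A x) \<and> supports A (supp A x) x"
proof -
  let ?P = "\<lambda>N. finite N \<and> supports A N x"
  have "\<exists>N. ?P N"
    using assms by (simp add: nominal_set_def finitely_supported_def)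
  then obtain N where N: "?P N" and least: "\<And>M. ?P M \<Longrightarrow> card N \<le> card M"
    using ex_has_least_nat[of ?P _ card] by blast
  have "N \<subseteq> M" if "?P M" for M
  proof -
    have "card N \<le> card (N \<inter> M)"
      using N that assms by (intro least) (simp add: supports_Int)
    then have "N \<inter> M = N"
      using N by (intro card_seteq) auto
    then show ?thesis by blast
  qed
  with N have "supp A x = N"
    unfolding supp_def by blast
  with N show ?thesis by simp
qed

lemmas finite_supp = finite_supp_and_supports_supp[THEN conjunct1]
  and supports_supp = finite_supp_and_supports_supp[THEN conjunct2]

text \<open>One inclusion, \<open>sub\<close>, holds for all permutations and elements; its instance
  at \<open>inverse \<pi>\<close> and \<open>act A \<pi> x\<close> gives the converse.\<close>

lemma supp_act:
  assumes A: "nominal_set A" "x \<in> elems A" and \<pi>: "\<pi> \<in> perms"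
  shows "supp A (act A \<pi> x) = apply \<pi> ` supp A x"
proof
  have sub: "supp A (act A \<rho> y) \<subseteq> apply \<rho> ` supp A y"
    if "\<rho> \<in> perms" "y \<in> elems A" for \<rho> y
    using A(1) that
    by (intro supp_subset finite_imageI finite_supp supports_act supports_supp)
  show "supp A (act A \<pi> x) \<subseteq> apply \<pi> ` supp A x"
    using sub A(2) \<pi> by blast
  have "supp A x \<subseteq> apply (inverse \<pi>) ` supp A (act A \<pi> x)"
    using sub[of "inverse \<pi>" "act A \<pi> x"] assms
    by (simp add: perms_inverse nominal_set_act_in nominal_set_act_inverse)
  then show "apply \<pi> ` supp A x \<subseteq> supp A (act A \<pi> x)"
    by auto
qed

lemma act_eq_if_fixes_supp:
  assumes "nominal_set A" "x \<in> elems A" "\<pi> \<in> perms" "\<And>a. a \<in> supp A x \<Longrightarrow> \<pi> \<langle>$\<rangle> a = a"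
  shows "act A \<pi> x = x"
  using supports_supp[OF assms(1,2)] assms(3,4) by (simp add: supports_def)


section \<open>Alpha-equivalence\<close>

lemma alpha_rel_iff:
  "((N, x), (N', x')) \<in> alpha_rel A \<longleftrightarrow>
    finite N \<and> x \<in> elems A \<and> finite N' \<and> x' \<in> elems A \<and>
    (\<exists>\<pi>\<in>perms. apply \<pi> ` N = N' \<and> act A \<pi> x = x' \<and> (\<forall>a\<in>supp A x - N. \<pi> \<langle>$\<rangle> a = a))"
  by (auto simp: alpha_rel_def prod_ns_def pfin_name_ns_def pow_ns_def name_ns_def)

lemma alpha_rel_refl:
  assumes "nominal_set A" "finite N" "x \<in> elems A"
  shows "((N, x), (N, x)) \<in> alpha_rel A"
  unfolding alpha_rel_iff using assms
  by (auto simp: nominal_set_act_one intro!: bexI[OF _ perms_one])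

text \<open>The free names on both sides coincide: by \<open>supp_act\<close>,
  \<open>supp A x' - N'\<close> is the image of \<open>supp A x - N\<close> under
  \<open>\<pi>\<close>, which is the identity there. So the inverse renaming is a witness.\<close>

lemma alpha_rel_sym:
  assumes "nominal_set A"
  shows "sym (alpha_rel A)"
proof (rule symI, clarify)
  fix N x N' x'
  assume "((N, x), (N', x')) \<in> alpha_rel A"
  then obtain \<pi> where \<pi>: "\<pi> \<in> perms" "N' = apply \<pi> ` N" "x' = act A \<pi> x"
      "\<forall>a\<in>supp A x - N. \<pi> \<langle>$\<rangle> a = a"
    and el: "finite N" "x \<in> elems A" "finite N'" "x' \<in> elems A"
    unfolding alpha_rel_iff by blast
  have "inverse \<pi> \<langle>$\<rangle> a = a" if "a \<in> supp A x' - N'" for a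
  proof -
    from that obtain b where "b \<in> supp A x - N" "a = \<pi> \<langle>$\<rangle> b"
      using \<pi>(2,3) supp_act[OF assms el(2) \<pi>(1)] by auto
    with \<pi>(4) show ?thesis by (metis apply_inverse_apply)
  qed
  moreover have "apply (inverse \<pi>) ` N' = N"
    by (simp add: \<pi>(2) image_image)
  moreover have "act A (inverse \<pi>) x' = x"
    using assms \<pi> el by (simp add: nominal_set_act_inverse)
  ultimately show "((N', x'), (N, x)) \<in> alpha_rel A"
    unfolding alpha_rel_iff using el perms_inverse[OF \<pi>(1)] by blast
qed

lemma alpha_rel_trans:
  assumes "nominal_set A"
  shows "trans (alpha_rel A)"
proof (rule transI, clarify)
  fix N x N' x' N'' x''
  assume "((N, x), (N', x')) \<in> alpha_rel A" "((N', x'), (N'', x'')) \<in> alpha_rel A"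
  then obtain \<pi> \<rho> where \<pi>: "\<pi> \<in> perms" "N' = apply \<pi> ` N" "x' = act A \<pi> x"
      "\<forall>a\<in>supp A x - N. \<pi> \<langle>$\<rangle> a = a"
    and \<rho>: "\<rho> \<in> perms" "N'' = apply \<rho> ` N'" "x'' = act A \<rho> x'"
      "\<forall>a\<in>supp A x' - N'. \<rho> \<langle>$\<rangle> a = a"
    and el: "finite N" "x \<in> elems A" "finite N''" "x'' \<in> elems A"
    unfolding alpha_rel_iff by blast
  have "(\<rho> * \<pi>) \<langle>$\<rangle> a = a" if a: "a \<in> supp A x - N" for a
  proof -
    \<comment> \<open>By \<open>supp_act\<close>, \<open>\<pi>\<close> carries free names of
      \<open>x\<close> to free names of \<open>x'\<close>, which puts \<open>a\<close> itself in the
      range where \<open>\<rho>\<close> is the identity.\<close>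
    have "\<pi> \<langle>$\<rangle> a \<in> supp A x' - N'"
      using a \<pi>(2,3) supp_act[OF assms el(2) \<pi>(1)] by (auto simp: apply_inj)
    moreover have "\<pi> \<langle>$\<rangle> a = a" using \<pi>(4) a by blast
    ultimately show ?thesis using \<rho>(4) by (simp add: apply_times)
  qed
  moreover have "apply (\<rho> * \<pi>) ` N = N''"
    by (simp add: \<pi>(2) \<rho>(2) apply_times image_comp)
  moreover have "act A (\<rho> * \<pi>) x = x''"
    using assms \<pi> \<rho> el by (simp add: nominal_set_act_times)
  ultimately show "((N, x), (N'', x'')) \<in> alpha_rel A"
    unfolding alpha_rel_iff using el perms_times[OF \<rho>(1) \<pi>(1)] by blast
qed

lemma abstr_eqI:
  assumes "nominal_set A" "((N, x), (N', x')) \<in> alpha_rel A"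
  shows "abstr A N x = abstr A N' x'"
  using symD[OF alpha_rel_sym[OF assms(1)]] transD[OF alpha_rel_trans[OF assms(1)]] assms(2)
  unfolding abstr_def by blast

text \<open>A renaming \<open>\<rho>\<close> witnessing alpha-equivalence is constrained only on
  \<open>supp A x\<close>, so it may move names of \<open>K\<close>. It is replaced by a
  \<open>\<pi>\<close> that agrees with it on \<open>N\<close> and moves nothing outside
  \<open>N \<union> N'\<close>, a set disjoint from \<open>K\<close>.\<close>

lemma abstr_eq_renaming:
  assumes A: "nominal_set A" and el: "finite N'" "x' \<in> elems A"
    and eq: "abstr A N x = abstr A N' x'" and K: "K \<inter> N = {}" "K \<inter> N' = {}"
  obtains \<pi> where "\<pi> \<in> perms" "apply \<pi> ` N = N'" "act A \<pi> x = x'"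
    "\<And>a. a \<in> supp A x - N \<Longrightarrow> \<pi> \<langle>$\<rangle> a = a" "\<And>a. a \<in> K \<Longrightarrow> \<pi> \<langle>$\<rangle> a = a"
proof -
  \<comment> \<open>By reflexivity \<open>(N', x')\<close> belongs to its own class, hence to that
    of \<open>(N, x)\<close>; this also yields that \<open>N\<close> is finite and \<open>x\<close>
    is in the carrier.\<close>
  have "((N, x), (N', x')) \<in> alpha_rel A"
    using alpha_rel_refl[OF A el] eq unfolding abstr_def by blast
  then obtain \<rho> where \<rho>: "\<rho> \<in> perms" "apply \<rho> ` N = N'" "act A \<rho> x = x'"
      "\<And>a. a \<in> supp A x - N \<Longrightarrow> \<rho> \<langle>$\<rangle> a = a"
    and x: "finite N" "x \<in> elems A"
    unfolding alpha_rel_iff by blast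
  obtain \<pi> where \<pi>: "\<pi> \<in> perms" "\<And>a. a \<in> N \<Longrightarrow> \<pi> \<langle>$\<rangle> a = \<rho> \<langle>$\<rangle> a"
    "\<And>a. a \<notin> N \<union> N' \<Longrightarrow> \<pi> \<langle>$\<rangle> a = a"
    using ex_perm_agreeing_on[OF x(1) \<rho>(1)] \<rho>(2) by blast
  \<comment> \<open>A free name cannot lie in \<open>N'\<close>: it is fixed by
    \<open>\<rho>\<close>, and \<open>\<rho>\<close> maps only names of \<open>N\<close> into
    \<open>N'\<close>.\<close>
  have fix_free: "\<pi> \<langle>$\<rangle> a = a" if a: "a \<in> supp A x - N" for a
  proof (rule \<pi>(3))
    have "\<rho> \<langle>$\<rangle> a \<notin> apply \<rho> ` N"
      using a by (auto simp: apply_inj)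
    then show "a \<notin> N \<union> N'"
      using a \<rho>(2) \<rho>(4)[OF a] by simp
  qed
  have "\<pi> \<langle>$\<rangle> a = \<rho> \<langle>$\<rangle> a" if "a \<in> supp A x" for a
    using that \<pi>(2) fix_free \<rho>(4) by (cases "a \<in> N") auto
  then have "act A \<pi> x = x'"
    using supports_cong[OF A x(2) supports_supp[OF A x(2)] \<pi>(1) \<rho>(1)] \<rho>(3) by simp
  moreover have "apply \<pi> ` N = N'"
    using \<pi>(2) \<rho>(2) by auto
  moreover have "\<pi> \<langle>$\<rangle> a = a" if "a \<in> K" for a
    using that K \<pi>(3) by blast
  ultimately show ?thesis
    using that \<pi>(1) fix_free by blast
qed

text \<open>With nothing bound, the renaming fixes all of \<open>supp A x\<close> and therefore
  \<open>x\<close>.\<close>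

lemma abstr_empty_eqD:
  assumes "nominal_set A" "x \<in> elems A" "x' \<in> elems A" "abstr A {} x = abstr A {} x'"
  shows "x = x'"
proof -
  obtain \<pi> where "\<pi> \<in> perms" "act A \<pi> x = x'" "\<And>a. a \<in> supp A x - {} \<Longrightarrow> \<pi> \<langle>$\<rangle> a = a"
    using abstr_eq_renaming[OF assms(1) finite.emptyI assms(3,4), of "{}"] by auto
  then show ?thesis using act_eq_if_fixes_supp[OF assms(1,2)] by auto
qed


section \<open>Constructions of nominal sets\<close>

lemma nominal_set_prod:
  assumes "nominal_set A" "nominal_set B"
  shows "nominal_set (prod_ns A B)"
proof -
  have "finitely_supported (prod_ns A B) (x, y)" if "x \<in> elems A" "y \<in> elems B" for x y
    unfolding finitely_supported_def
    using supports_supp[OF assms(1) that(1)] supports_supp[OF assms(2) that(2)]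
      finite_supp[OF assms(1) that(1)] finite_supp[OF assms(2) that(2)]
    by (intro exI[of _ "supp A x \<union> supp B y"]) (simp add: supports_def prod_ns_def)
  then show ?thesis
    using assms by (auto simp: nominal_set_def prod_ns_def)
qed

lemma nominal_set_sum:
  assumes "nominal_set A" "nominal_set B"
  shows "nominal_set (sum_ns A B)"
  using assms by (auto simp: nominal_set_def sum_ns_def finitely_supported_def supports_def)

text \<open>\<open>pfs_ns\<close> changes only the carrier of \<open>pow_ns\<close>, and finite
  support refers to the action alone.\<close>

lemma elems_pfs_ns:
  "X \<in> elems (pfs_ns A) \<longleftrightarrow> X \<subseteq> elems A \<and> finitely_supported (pfs_ns A) X"
  by (simp add: pfs_ns_def pow_ns_def finitely_supported_def supports_def)

lemma act_pfs_ns: "act (pfs_ns A) \<pi> X = act A \<pi> ` X"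
  by (simp add: pfs_ns_def pow_ns_def)

lemma nominal_set_pfs:
  assumes A: "nominal_set A"
  shows "nominal_set (pfs_ns A)"
proof -
  have one: "act A 1 ` X = X" if "X \<subseteq> elems A" for X
    using that A by (force simp: nominal_set_act_one)
  have times: "act A (\<pi> * \<rho>) ` X = act A \<pi> ` act A \<rho> ` X"
    if "X \<subseteq> elems A" "\<pi> \<in> perms" "\<rho> \<in> perms" for X \<pi> \<rho>
    using that A by (force simp: nominal_set_act_times image_image)
  have "finitely_supported (pfs_ns A) (act A \<pi> ` X)"
    if X: "X \<subseteq> elems A" and \<pi>: "\<pi> \<in> perms" and fs: "finitely_supported (pfs_ns A) X" for X \<pi>
  proof -
    obtain N where N: "finite N" "supports (pfs_ns A) N X"
      using fs by (auto simp: finitely_supported_def)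
    have "act A \<rho> ` act A \<pi> ` X = act A \<pi> ` X"
      if \<rho>: "\<rho> \<in> perms" "\<forall>a\<in>apply \<pi> ` N. \<rho> \<langle>$\<rangle> a = a" for \<rho>
    proof -
      \<comment> \<open>The conjugate of \<open>\<rho>\<close> by \<open>\<pi>\<close> fixes
        \<open>N\<close> pointwise, since \<open>\<rho>\<close> fixes the image of \<open>N\<close>
        under \<open>\<pi>\<close>; so it leaves \<open>X\<close> invariant.\<close>
      let ?\<sigma> = "inverse \<pi> * (\<rho> * \<pi>)"
      have \<sigma>: "?\<sigma> \<in> perms"
        by (intro perms_times perms_inverse \<pi> \<rho>)
      have "act A ?\<sigma> ` X = X"
        using N(2) \<sigma> \<rho>(2) by (simp add: supports_def act_pfs_ns apply_times)
      then have "act A \<pi> ` X = act A (\<pi> * ?\<sigma>) ` X"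
        using times[OF X \<pi> \<sigma>] by simp
      also have "\<pi> * ?\<sigma> = \<rho> * \<pi>"
        by (simp flip: mult.assoc)
      finally show ?thesis
        using times[OF X \<rho>(1) \<pi>] by simp
    qed
    then show ?thesis
      unfolding finitely_supported_def using N(1)
      by (intro exI[of _ "apply \<pi> ` N"]) (simp add: supports_def act_pfs_ns)
  qed
  moreover have "act A \<pi> ` X \<subseteq> elems A" if "X \<subseteq> elems A" "\<pi> \<in> perms" for X \<pi>
    using that A by (auto simp: nominal_set_act_in)
  ultimately show ?thesis
    by (simp add: nominal_set_def elems_pfs_ns act_pfs_ns one times)
qed

section \<open>States of the transform as a nominal set\<close>

lemma elems_effect_ns: "elems (effect_ns T \<F>) = \<F>"
  by (simp add: effect_ns_def)

lemma AC_in_lstate_ns: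
  "AC f F P \<in> elems (lstate_ns T \<F>) \<longleftrightarrow>
    f \<in> \<F> \<and> F \<in> elems (pfs_effects T \<F>) \<and> P \<in> elems (states T)"
  by (auto simp: lstate_ns_def)

lemma EF_in_lstate_ns:
  "EF F P \<in> elems (lstate_ns T \<F>) \<longleftrightarrow> F \<in> elems (pfs_effects T \<F>) \<and> P \<in> elems (states T)"
  by (auto simp: lstate_ns_def)

lemma supports_AC:
  assumes "supports (effect_ns T \<F>) N\<^sub>1 f" "supports (pfs_effects T \<F>) N\<^sub>2 F"
    "supports (states T) N\<^sub>3 P"
  shows "supports (lstate_ns T \<F>) (N\<^sub>1 \<union> N\<^sub>2 \<union> N\<^sub>3) (AC f F P)"
  using assms by (simp add: supports_def lstate_ns_def)

lemma supports_EF: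
  assumes "supports (pfs_effects T \<F>) N\<^sub>1 F" "supports (states T) N\<^sub>2 P"
  shows "supports (lstate_ns T \<F>) (N\<^sub>1 \<union> N\<^sub>2) (EF F P)"
  using assms by (simp add: supports_def lstate_ns_def)

lemma nominal_set_lstate:
  assumes S: "nominal_set (states T)" and E: "nominal_set (effect_ns T \<F>)"
  shows "nominal_set (lstate_ns T \<F>)"
  unfolding nominal_set_def
proof (intro conjI ballI)
  note F = nominal_set_pfs[OF E]
  note E' = E[unfolded nominal_set_def elems_effect_ns]
  note F' = F[unfolded nominal_set_def]
  note S' = S[unfolded nominal_set_def]
  have act: "act (lstate_ns T \<F>) = lstate_act T \<F>"
    by (simp add: lstate_ns_def)
  fix x assume x: "x \<in> elems (lstate_ns T \<F>)"
  show "act (lstate_ns T \<F>) 1 x = x"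
    using x E' F' S' by (cases x) (auto simp: act AC_in_lstate_ns EF_in_lstate_ns)
  show "finitely_supported (lstate_ns T \<F>) x"
  proof (cases x)
    case (AC f G P)
    with x have el: "f \<in> elems (effect_ns T \<F>)" "G \<in> elems (pfs_effects T \<F>)"
      "P \<in> elems (states T)"
      by (auto simp: AC_in_lstate_ns elems_effect_ns)
    show ?thesis
      unfolding AC
      using supports_AC[OF supports_supp[OF E el(1)] supports_supp[OF F el(2)]
          supports_supp[OF S el(3)]]
        finite_supp[OF E el(1)] finite_supp[OF F el(2)] finite_supp[OF S el(3)]
      by (auto intro: finitely_supportedI[rotated])
  next
    case (EF G P)
    with x have el: "G \<in> elems (pfs_effects T \<F>)" "P \<in> elems (states T)"
      by (auto simp: EF_in_lstate_ns)
    show ?thesis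
      unfolding EF
      using supports_EF[OF supports_supp[OF F el(1)] supports_supp[OF S el(2)]]
        finite_supp[OF F el(1)] finite_supp[OF S el(2)]
      by (auto intro: finitely_supportedI[rotated])
  qed
  fix \<pi> :: "'a perm" assume \<pi>: "\<pi> \<in> perms"
  show "act (lstate_ns T \<F>) \<pi> x \<in> elems (lstate_ns T \<F>)"
    using x \<pi> E' F' S' by (cases x) (auto simp: act AC_in_lstate_ns EF_in_lstate_ns)
  fix \<rho> :: "'a perm" assume \<rho>: "\<rho> \<in> perms"
  show "act (lstate_ns T \<F>) (\<pi> * \<rho>) x = act (lstate_ns T \<F>) \<pi> (act (lstate_ns T \<F>) \<rho> x)"
    using x \<pi> \<rho> E' F' S' by (cases x) (auto simp: act AC_in_lstate_ns EF_in_lstate_ns)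
qed

text \<open>Combines the three freshness premises of \<open>L_bisimulation\<close> into the single
  one that \<open>bisimulation\<close> demands of the answering state. The supports of the
  components together support the state.\<close>

lemma fresh_AC:
  assumes S: "nominal_set (states T)" and E: "nominal_set (effect_ns T \<F>)"
    and el: "f \<in> \<F>" "F \<in> elems (pfs_effects T \<F>)" "P \<in> elems (states T)"
    and fr: "fresh (effect_ns T \<F>) N f" "fresh (pfs_effects T \<F>) N F" "fresh (states T) N P"
  shows "fresh (lstate_ns T \<F>) N (AC f F P)"
proof -
  note F = nominal_set_pfs[OF E]
  have f: "f \<in> elems (effect_ns T \<F>)" by (simp add: elems_effect_ns el)
  have "supp (lstate_ns T \<F>) (AC f F P) \<subseteq>
      supp (effect_ns T \<F>) f \<union> supp (pfs_effects T \<F>) F \<union> supp (states T) P"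
    by (intro supp_subset supports_AC finite_UnI supports_supp finite_supp S E F f el)
  then show ?thesis
    using fr by (auto simp: fresh_def)
qed


section \<open>The transform reflects bisimilarity\<close>

lemma L_transform_simps:
  "states (L_transform T \<F> L) = lstate_ns T \<F>"
  "preds (L_transform T \<F> L) = preds T"
  "actions (L_transform T \<F> L) = laction_ns T \<F>"
  "bn (L_transform T \<F> L) = lbn T"
  "residual (L_transform T \<F> L) = abstr (prod_ns (laction_ns T \<F>) (lstate_ns T \<F>))"
  by (simp_all add: L_transform_def residual_def)

lemma L_transform_sat_AC:
  "(AC f F P, \<phi>) \<in> sat (L_transform T \<F> L) \<longleftrightarrow>
    AC f F P \<in> elems (lstate_ns T \<F>) \<and> (P, \<phi>) \<in> sat T"
  by (auto simp: L_transform_def)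

locale effect_nts =
  fixes T :: "('n::name, 's, 'p, 'a) nts" and \<F> :: "('s \<Rightarrow> 's) set"
    and L :: "('s, 'a) effect_update"
  assumes nts: "nominal_transition_system T"
    and effects: "nominal_effect_set T \<F>"
    and update: "equivariant_update T \<F> L"
begin

abbreviation "lres_ns \<equiv> prod_ns (laction_ns T \<F>) (lstate_ns T \<F>)"

lemma nominal_sets:
  "nominal_set (states T)" "nominal_set (actions T)" "nominal_set (effect_ns T \<F>)"
  using nts effects by (simp_all add: nominal_transition_system_def nominal_effect_set_def)

lemma nominal_set_lres: "nominal_set lres_ns"
  unfolding laction_ns_def
  by (intro nominal_set_prod nominal_set_sum nominal_set_lstate nominal_sets)

lemma finite_bn: "\<alpha> \<in> elems (actions T) \<Longrightarrow> finite (bn T \<alpha>)"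
  using nts by (auto simp: nominal_transition_system_def equivariant_fun_def pfin_name_ns_def)

lemma effect_in_states: "f \<in> \<F> \<Longrightarrow> P \<in> elems (states T) \<Longrightarrow> f P \<in> elems (states T)"
  using effects by (auto simp: nominal_effect_set_def is_effect_def fun_ns_def)

lemma effect_set_subset: "F \<in> elems (pfs_effects T \<F>) \<Longrightarrow> F \<subseteq> \<F>"
  by (simp add: elems_pfs_ns elems_effect_ns)

lemma update_in:
  assumes "\<alpha> \<in> elems (actions T)" "F \<in> elems (pfs_effects T \<F>)" "f \<in> \<F>"
  shows "L (\<alpha>, F, f) \<in> elems (pfs_effects T \<F>)"
  using update assms
  by (auto simp: equivariant_update_def equivariant_fun_def prod_ns_def elems_effect_ns)

lemma act_update:
  assumes "\<alpha> \<in> elems (actions T)" "F \<in> elems (pfs_effects T \<F>)" "f \<in> \<F>" "\<pi> \<in> perms"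
  shows "act (pfs_effects T \<F>) \<pi> (L (\<alpha>, F, f)) =
    L (act (actions T) \<pi> \<alpha>, act (pfs_effects T \<F>) \<pi> F, act (effect_ns T \<F>) \<pi> f)"
  using update assms
  by (auto simp: equivariant_update_def equivariant_fun_def prod_ns_def elems_effect_ns)

section \<open>Transitions of the transform: introduction and inversion\<close>

lemma step_EF:
  assumes "EF F P \<in> elems (lstate_ns T \<F>)" "f \<in> F"
  shows "step (L_transform T \<F> L) (EF F P) (Inr f) (AC f F (f P))"
  using assms by (auto simp: step_def L_transform_simps) (auto simp: L_transform_def)

lemma step_AC:
  assumes "AC f F P \<in> elems (lstate_ns T \<F>)" "\<alpha> \<in> elems (actions T)" "P' \<in> elems (states T)"
    "step T P \<alpha> P'" "fresh (effect_ns T \<F>) (bn T \<alpha>) f" "fresh (pfs_effects T \<F>) (bn T \<alpha>) F"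
  shows "step (L_transform T \<F> L) (AC f F P) (Inl \<alpha>) (EF (L (\<alpha>, F, f)) P')"
  using assms by (auto simp: step_def[of "L_transform T \<F> L"] L_transform_simps)
    (auto simp: L_transform_def)

text \<open>A transition is only known to have the same residual class as a generating one, but
  effect labels bind no names, so \<open>abstr_empty_eqD\<close> identifies both label and
  target.\<close>

lemma step_EF_cases:
  assumes step: "step (L_transform T \<F> L) (EF F P) (Inr f) S"
    and S: "S \<in> elems (lstate_ns T \<F>)" and f: "f \<in> \<F>"
  shows "S = AC f F (f P)"
proof -
  let ?x = "(Inr f :: 'a + ('s \<Rightarrow> 's), S)"
  from step have "(EF F P, abstr lres_ns {} ?x) \<in> trans_rel (L_transform T \<F> L)"
    by (simp add: step_def L_transform_simps lbn_def)
  then obtain g where g: "EF F P \<in> elems (lstate_ns T \<F>)" "g \<in> F"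
    "abstr lres_ns {} ?x = abstr lres_ns {} (Inr g, AC g F (g P))"
    by (auto simp: L_transform_def lbn_def)
  have el: "F \<in> elems (pfs_effects T \<F>)" "P \<in> elems (states T)"
    using g(1) by (auto simp: EF_in_lstate_ns)
  then have "g \<in> \<F>" "g P \<in> elems (states T)"
    using g(2) effect_set_subset effect_in_states by auto
  then have "?x \<in> elems lres_ns" "(Inr g, AC g F (g P)) \<in> elems lres_ns"
    using S f el
    by (auto simp: prod_ns_def laction_ns_def sum_ns_def elems_effect_ns AC_in_lstate_ns)
  then have "?x = (Inr g, AC g F (g P))"
    using g(3) by (rule abstr_empty_eqD[OF nominal_set_lres])
  then show ?thesis by simp
qed

text \<open>A single renaming \<open>\<pi>\<close> from \<open>abstr_eq_renaming\<close>, with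
  \<open>K\<close> the names of \<open>f\<close> and \<open>F\<close>, does two jobs: it converts
  the index of the generating transition, and it shows that the underlying transition of
  \<open>T\<close> is an alpha-variant of one labelled \<open>\<alpha>\<close>.\<close>

lemma step_AC_cases:
  assumes step: "step (L_transform T \<F> L) (AC f F P) (Inl \<alpha>) S"
    and S: "S \<in> elems (lstate_ns T \<F>)" and \<alpha>: "\<alpha> \<in> elems (actions T)"
    and fr: "fresh (effect_ns T \<F>) (bn T \<alpha>) f" "fresh (pfs_effects T \<F>) (bn T \<alpha>) F"
  obtains P' where "P' \<in> elems (states T)" "step T P \<alpha> P'" "S = EF (L (\<alpha>, F, f)) P'"
proof -
  let ?x = "(Inl \<alpha> :: 'a + ('s \<Rightarrow> 's), S)"
  from step have "(AC f F P, abstr lres_ns (bn T \<alpha>) ?x) \<in> trans_rel (L_transform T \<F> L)"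
    by (simp add: step_def L_transform_simps lbn_def)
  then obtain \<beta> Q where AC: "AC f F P \<in> elems (lstate_ns T \<F>)"
    and \<beta>: "\<beta> \<in> elems (actions T)" and Q: "Q \<in> elems (states T)" and stepQ: "step T P \<beta> Q"
    and fr\<beta>: "fresh (effect_ns T \<F>) (bn T \<beta>) f" "fresh (pfs_effects T \<F>) (bn T \<beta>) F"
    and eq: "abstr lres_ns (bn T \<beta>) (Inl \<beta>, EF (L (\<beta>, F, f)) Q) = abstr lres_ns (bn T \<alpha>) ?x"
    by (auto simp: L_transform_def lbn_def)
  let ?y = "(Inl \<beta>, EF (L (\<beta>, F, f)) Q)"
  let ?K = "supp (effect_ns T \<F>) f \<union> supp (pfs_effects T \<F>) F"
  have el: "f \<in> \<F>" "f \<in> elems (effect_ns T \<F>)" "F \<in> elems (pfs_effects T \<F>)"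
    using AC by (auto simp: AC_in_lstate_ns elems_effect_ns)
  have x: "?x \<in> elems lres_ns"
    using \<alpha> S by (simp add: prod_ns_def laction_ns_def sum_ns_def InlI)
  have y: "?y \<in> elems lres_ns"
    using \<beta> Q update_in[OF \<beta> el(3,1)]
    by (simp add: prod_ns_def laction_ns_def sum_ns_def InlI EF_in_lstate_ns)
  have K: "?K \<inter> bn T \<beta> = {}" "?K \<inter> bn T \<alpha> = {}"
    using fr fr\<beta> by (auto simp: fresh_def)
  obtain \<pi> where \<pi>: "\<pi> \<in> perms" "apply \<pi> ` bn T \<beta> = bn T \<alpha>" "act lres_ns \<pi> ?y = ?x"
    "\<And>a. a \<in> supp lres_ns ?y - bn T \<beta> \<Longrightarrow> \<pi> \<langle>$\<rangle> a = a" "\<And>a. a \<in> ?K \<Longrightarrow> \<pi> \<langle>$\<rangle> a = a"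
    by (rule abstr_eq_renaming[OF nominal_set_lres finite_bn[OF \<alpha>] x eq K]) blast
  let ?P' = "act (states T) \<pi> Q"
  have "act (effect_ns T \<F>) \<pi> f = f"
    using \<pi>(1,5) el by (intro act_eq_if_fixes_supp nominal_sets) auto
  moreover have "act (pfs_effects T \<F>) \<pi> F = F"
    using \<pi>(1,5) el by (intro act_eq_if_fixes_supp nominal_set_pfs nominal_sets) auto
  moreover have \<pi>\<beta>: "act (actions T) \<pi> \<beta> = \<alpha>"
    and "S = EF (act (pfs_effects T \<F>) \<pi> (L (\<beta>, F, f))) ?P'"
    using \<pi>(3) by (auto simp: prod_ns_def laction_ns_def sum_ns_def lstate_ns_def)
  ultimately have S_eq: "S = EF (L (\<alpha>, F, f)) ?P'"
    using act_update[OF \<beta> el(3,1) \<pi>(1)] by simp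
  have P': "?P' \<in> elems (states T)"
    using Q \<pi>(1) nominal_sets by (simp add: nominal_set_act_in)
  let ?A = "prod_ns (actions T) (states T)"
  have A: "nominal_set ?A"
    by (intro nominal_set_prod nominal_sets)
  \<comment> \<open>The action is componentwise, so whatever fixes \<open>?y\<close> fixes both
    \<open>\<beta>\<close> and \<open>Q\<close>. Hence \<open>\<pi>\<close>, which fixes the free
    names of \<open>?y\<close>, fixes those of \<open>(\<beta>, Q)\<close> as well.\<close>
  have "supp ?A (\<beta>, Q) \<subseteq> supp lres_ns ?y"
    using supports_supp[OF nominal_set_lres y]
    by (intro supp_subset finite_supp[OF nominal_set_lres y])
      (simp add: supports_def prod_ns_def laction_ns_def sum_ns_def lstate_ns_def)
  then have "((bn T \<beta>, (\<beta>, Q)), (bn T \<alpha>, (\<alpha>, ?P'))) \<in> alpha_rel ?A"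
    unfolding alpha_rel_iff using \<alpha> \<beta> Q P' \<pi>(1,2,4) \<pi>\<beta>
    by (auto simp: prod_ns_def finite_bn intro!: bexI[of _ \<pi>])
  then have "residual T (bn T \<beta>) (\<beta>, Q) = residual T (bn T \<alpha>) (\<alpha>, ?P')"
    unfolding residual_def by (rule abstr_eqI[OF A])
  then have "step T P \<alpha> ?P'"
    using stepQ by (simp add: step_def)
  with P' S_eq show ?thesis by (intro that)
qed

text \<open>One round of the \<open>L\<close>-bisimulation game corresponds to two in the transform:
  \<open>Inr f\<close> leads to a pair of \<open>AC\<close> states, where predicates are compared,
  and \<open>Inl \<alpha>\<close> leads back to \<open>EF\<close> states carrying the updated
  index.\<close>

lemma L_bisimulation_of_bisimulation:
  assumes B: "bisimulation (L_transform T \<F> L) B"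
  shows "L_bisimulation T \<F> L
    (\<lambda>F. {(P, Q). P \<in> elems (states T) \<and> Q \<in> elems (states T) \<and> (EF F P, EF F Q) \<in> B})"
    (is "L_bisimulation T \<F> L ?R")
proof -
  note S = nominal_sets(1) and E = nominal_sets(3)
  have sim: "(\<forall>\<phi>\<in>elems (preds T). (X, \<phi>) \<in> sat (L_transform T \<F> L) \<longrightarrow>
        (Y, \<phi>) \<in> sat (L_transform T \<F> L)) \<and>
      (\<forall>\<alpha>\<in>elems (laction_ns T \<F>). \<forall>X'\<in>elems (lstate_ns T \<F>).
        fresh (lstate_ns T \<F>) (lbn T \<alpha>) Y \<longrightarrow> step (L_transform T \<F> L) X \<alpha> X' \<longrightarrow>
        (\<exists>Y'\<in>elems (lstate_ns T \<F>). step (L_transform T \<F> L) Y \<alpha> Y' \<and> (X', Y') \<in> B))"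
    if "(X, Y) \<in> B" for X Y
    using B that unfolding bisimulation_def L_transform_simps by blast
  have AC_B: "(AC f F (f P), AC f F (f Q)) \<in> B"
    if F: "F \<in> elems (pfs_effects T \<F>)" and R: "(P, Q) \<in> ?R F" and f: "f \<in> F" for F P Q f
  proof -
    have f': "f \<in> \<F>" using F f effect_set_subset by blast
    have "step (L_transform T \<F> L) (EF F P) (Inr f) (AC f F (f P))"
      using F R f by (intro step_EF) (auto simp: EF_in_lstate_ns)
    moreover have "Inr f \<in> elems (laction_ns T \<F>)"
      using f' by (simp add: laction_ns_def sum_ns_def elems_effect_ns InrI)
    moreover have "AC f F (f P) \<in> elems (lstate_ns T \<F>)"
      using F R f' by (simp add: AC_in_lstate_ns effect_in_states)
    moreover have "fresh (lstate_ns T \<F>) (lbn T (Inr f)) (EF F Q)"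
      by (simp add: fresh_def lbn_def)
    ultimately obtain Y where "Y \<in> elems (lstate_ns T \<F>)"
      "step (L_transform T \<F> L) (EF F Q) (Inr f) Y" "(AC f F (f P), Y) \<in> B"
      using sim[of "EF F P" "EF F Q"] R by blast
    then show ?thesis using step_EF_cases f' by blast
  qed
  have "(f Q, \<phi>) \<in> sat T"
    if F: "F \<in> elems (pfs_effects T \<F>)" and R: "(P, Q) \<in> ?R F" and f: "f \<in> F"
      and \<phi>: "\<phi> \<in> elems (preds T)" "(f P, \<phi>) \<in> sat T" for F P Q f \<phi>
  proof -
    have "AC f F (f P) \<in> elems (lstate_ns T \<F>)"
      using F R subsetD[OF effect_set_subset[OF F] f]
      by (simp add: AC_in_lstate_ns effect_in_states)
    then show ?thesis
      using sim[OF AC_B[OF F R f]] \<phi> by (simp add: L_transform_sat_AC)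
  qed
  moreover have "\<exists>Q'\<in>elems (states T). step T (f Q) \<alpha> Q' \<and> (P', Q') \<in> ?R (L (\<alpha>, F, f))"
    if F: "F \<in> elems (pfs_effects T \<F>)" and R: "(P, Q) \<in> ?R F" and f: "f \<in> F"
      and \<alpha>: "\<alpha> \<in> elems (actions T)" and P': "P' \<in> elems (states T)"
      and fr: "fresh (states T) (bn T \<alpha>) (f Q)" "fresh (pfs_effects T \<F>) (bn T \<alpha>) F"
        "fresh (effect_ns T \<F>) (bn T \<alpha>) f"
      and st: "step T (f P) \<alpha> P'" for F P Q f \<alpha> P'
  proof -
    have f': "f \<in> \<F>" using F f effect_set_subset by blast
    have "step (L_transform T \<F> L) (AC f F (f P)) (Inl \<alpha>) (EF (L (\<alpha>, F, f)) P')"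
      using F R f' \<alpha> P' st fr by (intro step_AC) (auto simp: AC_in_lstate_ns effect_in_states)
    moreover have "Inl \<alpha> \<in> elems (laction_ns T \<F>)"
      using \<alpha> by (simp add: laction_ns_def sum_ns_def InlI)
    moreover have "EF (L (\<alpha>, F, f)) P' \<in> elems (lstate_ns T \<F>)"
      using update_in[OF \<alpha> F f'] P' by (simp add: EF_in_lstate_ns)
    moreover have "fresh (lstate_ns T \<F>) (lbn T (Inl \<alpha>)) (AC f F (f Q))"
      using F R f' fr effect_in_states by (auto simp: lbn_def intro!: fresh_AC[OF S E])
    ultimately obtain Y where Y: "Y \<in> elems (lstate_ns T \<F>)"
      "step (L_transform T \<F> L) (AC f F (f Q)) (Inl \<alpha>) Y" "(EF (L (\<alpha>, F, f)) P', Y) \<in> B"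
      using sim[OF AC_B[OF F R f]] by blast
    \<comment> \<open>Inversion shows that the answer carries the same index
      \<open>L (\<alpha>, F, f)\<close> as the challenge, so the pair lands in the required member
      of the family.\<close>
    obtain Q' where "Q' \<in> elems (states T)" "step T (f Q) \<alpha> Q'" "Y = EF (L (\<alpha>, F, f)) Q'"
      by (rule step_AC_cases[OF Y(2,1) \<alpha> fr(3,2)])
    then show ?thesis using Y(3) P' by blast
  qed
  moreover have "sym (?R F)" for F
    using B by (auto simp: bisimulation_def sym_def)
  ultimately show ?thesis
    unfolding L_bisimulation_def by blast
qed

end

theorem theorem6p13:
  fixes T :: "('n::name, 's, 'p, 'a) nts"
    and \<F> :: "('s \<Rightarrow> 's) set"
    and L :: "'a \<times> ('s \<Rightarrow> 's) set \<times> ('s \<Rightarrow> 's) \<Rightarrow> ('s \<Rightarrow> 's) set"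
    and F :: "('s \<Rightarrow> 's) set"
    and P Q :: 's
  assumes "nominal_transition_system T"
    and "nominal_effect_set T \<F>"
    and "equivariant_update T \<F> L"
    and "F \<in> elems (pfs_effects T \<F>)"
    and "P \<in> elems (states T)" and "Q \<in> elems (states T)"
    and "(EF F P, EF F Q) \<in> bisimilarity (L_transform T \<F> L)"
  shows "L_bisimilar T \<F> L F P Q"
proof -
  interpret effect_nts T \<F> L
    using assms(1-3) by unfold_locales
  obtain B where "bisimulation (L_transform T \<F> L) B" "(EF F P, EF F Q) \<in> B"
    using assms(7) by (auto simp: bisimilarity_def)
  then show ?thesis
    unfolding L_bisimilar_def using L_bisimulation_of_bisimulation assms(5,6) by blast
qed

end
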